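(* Let $j,k$ be positive integers with $\mathbf{B}_j^k$ finite and let $m = \max(\mathbf{B}_j^k)$. Suppose $\mathbf{B}_{j+1}^k = \{1\} \cup \{ n+1 : n \in \mathbf{B}_j^k\}$ and $\left\lfloor \sqrt[k]{(m-j)\left(1 + \frac{1}{2^k-1}\right)} \right\rfloor = \left\lfloor \sqrt[k]{m} \right\rfloor.$ Then $\mathbf{B}^k = \{ n - j : n \in \mathbf{B}_j^k,\ n > j\}$, and $\overline{\mathbf{B}_l^k} = \emptyset$ for all $l \ge j$.
   Context: For positive integers $j,k$, a positive integer $n$ is called $(j,k)$-representable if $n = x_1^k + \cdots + x_j^k$ with all $x_i$ positive integers. Let $\mathbf{B}_j^k$ denote the set of positive integers that are not $(j,k)$-representable, and put $S_j^k = \{ n - j : n \in \mathbf{B}_j^k,\ n > j\}$. Define $\mathbf{B}^k = \bigcap_{j \ge 1} S_j^k$ (the eventual common value of the non-increasing chain $S_j^k$) and $\overline{\mathbf{B}_j^k} = S_j^k \setminus \mathbf{B}^k$. *)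

theory Defs
  imports Complex_Main
begin

definition representable :: "nat \<Rightarrow> nat \<Rightarrow> nat \<Rightarrow> bool" where
  "representable j k n \<longleftrightarrow>
     (\<exists>x :: nat \<Rightarrow> nat. (\<forall>i\<in>{1..j}. x i > 0) \<and> n = (\<Sum>i=1..j. x i ^ k))"

definition B :: "nat \<Rightarrow> nat \<Rightarrow> nat set" where
  "B j k = {n. n > 0 \<and> \<not> representable j k n}"

definition S :: "nat \<Rightarrow> nat \<Rightarrow> nat set" where
  "S j k = {n - j | n. n \<in> B j k \<and> n > j}"

definition B_lim :: "nat \<Rightarrow> nat set" where
  "B_lim k = (\<Inter>j\<in>{1..}. S j k)"

definition B_bar :: "nat \<Rightarrow> nat \<Rightarrow> nat set" where
  "B_bar j k = S j k - B_lim k"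

end

theory Submission
  imports Defs
begin

text \<open>
  Adding the summand 1 to a representation shows that the sets \<open>S l k\<close> decrease in \<open>l\<close>.
  The hypothesis on \<open>B (j + 1) k\<close> says that whenever \<open>n + 1\<close> is a sum of \<open>j + 1\<close> positive
  \<open>k\<close>-th powers, \<open>n\<close> is a sum of \<open>j\<close> of them. This property passes from \<open>j\<close> to \<open>j + 1\<close>:
  set one summand aside and apply it to the remaining ones. Hence the chain is
  constant from \<open>j\<close> on.
\<close>

text \<open>Splitting off the last summand gives a recursion in the number of summands, so later
  inductions need not handle the function \<open>x\<close>.\<close>

lemma representable_Suc:
  "representable (Suc j) k n \<longleftrightarrow> (\<exists>m y. representable j k m \<and> y > 0 \<and> n = m + y ^ k)"
proof
  assume "representable (Suc j) k n"
  then obtain x where "\<forall>i\<in>{1..Suc j}. x i > 0" "n = (\<Sum>i=1..Suc j. x i ^ k)"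
    unfolding representable_def by blast
  then have "representable j k (\<Sum>i=1..j. x i ^ k) \<and> x (Suc j) > 0 \<and>
      n = (\<Sum>i=1..j. x i ^ k) + x (Suc j) ^ k"
    by (auto simp: representable_def intro!: exI[of _ x])
  then show "\<exists>m y. representable j k m \<and> y > 0 \<and> n = m + y ^ k" by blast
next
  assume "\<exists>m y. representable j k m \<and> y > 0 \<and> n = m + y ^ k"
  then obtain x y where x: "\<forall>i\<in>{1..j}. x i > 0" and y: "y > 0"
    and n: "n = (\<Sum>i=1..j. x i ^ k) + y ^ k"
    unfolding representable_def by blast
  have "(\<Sum>i=1..j. (x(Suc j := y)) i ^ k) = (\<Sum>i=1..j. x i ^ k)"
    by (rule sum.cong) auto
  with n have "n = (\<Sum>i=1..Suc j. (x(Suc j := y)) i ^ k)" by simp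
  moreover have "\<forall>i\<in>{1..Suc j}. (x(Suc j := y)) i > 0" using x y by auto
  ultimately show "representable (Suc j) k n"
    unfolding representable_def by blast
qed

lemma representable_ge: "representable j k n \<Longrightarrow> j \<le> n"
proof (induction j arbitrary: n)
  case (Suc j)
  then obtain m y where "j \<le> m" "y > 0" "n = m + y ^ k"
    unfolding representable_Suc by blast
  moreover from \<open>y > 0\<close> have "y ^ k > 0" by simp
  ultimately show ?case by linarith
qed simp

lemma representable_add_one: "representable j k n \<Longrightarrow> representable (Suc j) k (Suc n)"
  unfolding representable_Suc by (intro exI[of _ n] exI[of _ 1]) simp

lemma representable_remove_one:
  assumes base: "\<And>n. representable (Suc j) k (Suc n) \<Longrightarrow> representable j k n"
    and "j \<le> l" and "representable (Suc l) k (Suc n)"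
  shows "representable l k n"
  using assms(2,3)
proof (induction l arbitrary: n rule: dec_induct)
  case base
  then show ?case by (rule assms(1))
next
  case (step l)
  then obtain m y where m: "representable (Suc l) k m" and y: "y > 0" "Suc n = m + y ^ k"
    using representable_Suc[of "Suc l" k "Suc n"] by blast
  \<comment> \<open>The part \<open>m\<close> has \<open>Suc l\<close> positive summands, so it is
    at least 1; the 1 is taken from \<open>m\<close>, and \<open>y ^ k\<close> stays
    untouched.\<close>
  from representable_ge[OF m] obtain m' where "m = Suc m'" by (cases m) auto
  with step.IH m y have "representable l k m'" "n = m' + y ^ k" by auto
  with y(1) show ?case unfolding representable_Suc by blast
qed

text \<open>Taking \<open>n = t + l\<close> removes the truncated subtraction from \<open>S\<close>;
  \<open>t > 0\<close> then covers both \<open>n > l\<close> and \<open>n > 0\<close>.\<close>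

lemma mem_S_iff: "t \<in> S l k \<longleftrightarrow> t > 0 \<and> \<not> representable l k (t + l)"
proof
  assume "t \<in> S l k"
  then show "t > 0 \<and> \<not> representable l k (t + l)" unfolding S_def B_def by auto
next
  assume "t > 0 \<and> \<not> representable l k (t + l)"
  then show "t \<in> S l k"
    unfolding S_def B_def by (auto intro!: exI[of _ "t + l"])
qed

lemma S_antimono: "i \<le> l \<Longrightarrow> S l k \<subseteq> S i k"
proof (induction l rule: dec_induct)
  case (step l)
  have "S (Suc l) k \<subseteq> S l k"
    using representable_add_one[of l k] by (auto simp: mem_S_iff)
  with step.IH show ?case by blast
qed simp

lemma S_eventually_constant:
  assumes "\<And>n. representable (Suc j) k (Suc n) \<Longrightarrow> representable j k n" and "j \<le> l"
  shows "S l k = S j k"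
  using assms(2)
proof (induction l rule: dec_induct)
  case (step l)
  \<comment> \<open>By contraposition: \<open>t + Suc l\<close> is \<open>Suc (t + l)\<close>, so a
    representation of it would yield one of \<open>t + l\<close>.\<close>
  have "S l k \<subseteq> S (Suc l) k"
    using representable_remove_one[OF assms(1) step.hyps(1)] by (auto simp: mem_S_iff)
  with S_antimono[of l "Suc l" k] step.IH show ?case by auto
qed simp

theorem theorem10p17:
  fixes j k m :: nat
  assumes "j > 0" and "k > 0"
    and "finite (B j k)"
    and "m = Max (B j k)"
    and "B (j + 1) k = {1} \<union> {n + 1 | n. n \<in> B j k}"
    and "\<lfloor>root k ((real m - real j) * (1 + 1 / (2 ^ k - 1)))\<rfloor> = \<lfloor>root k (real m)\<rfloor>"
  shows "B_lim k = {n - j | n. n \<in> B j k \<and> n > j} \<and> (\<forall>l\<ge>j. B_bar l k = {})"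
proof -
  have remove: "representable j k n" if rep: "representable (Suc j) k (Suc n)" for n
  proof -
    from rep have "Suc n \<notin> B (j + 1) k" by (simp add: B_def)
    with assms(5) have "n \<notin> B j k" by auto
    \<comment> \<open>Lying outside \<open>B j k\<close> gives representability only for positive
      numbers; \<open>n = 0\<close> is excluded by \<open>Suc j <= Suc n\<close> and
      \<open>j > 0\<close>.\<close>
    moreover from representable_ge[OF rep] \<open>j > 0\<close> have "n > 0" by simp
    ultimately show ?thesis by (simp add: B_def)
  qed
  have const: "S l k = S j k" if "j \<le> l" for l
    using S_eventually_constant[OF remove that] .
  \<comment> \<open>\<open>S j k\<close> is the least set of the chain, by antimonotonicity for
    \<open>i <= j\<close> and by constancy for larger \<open>i\<close>, so the intersection is
    attained at \<open>j\<close>.\<close>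
  have "S j k \<subseteq> S i k" for i
    using S_antimono[of i j k] const[of i] by (cases "i \<le> j") auto
  with \<open>j > 0\<close> have "B_lim k = S j k"
    unfolding B_lim_def by (intro equalityI INF_lower INF_greatest) auto
  moreover from this have "B_bar l k = {}" if "j \<le> l" for l
    unfolding B_bar_def const[OF that] by simp
  ultimately show ?thesis
    by (simp flip: S_def)
qed

end
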